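(* The $k$-Path problem on $n$-vertex graphs can be solved by a deterministic one-pass streaming algorithm using $O(k\cdot n)$ space in insertion-only streams and $\widetilde{O}(k\cdot n)$ space in insertion-deletion streams.
   Context: $k$-Path: given an undirected graph $G$ on $n$ vertices, decide whether $G$ has a path of length at least $k$ (a path on at least $k+1$ vertices). Streaming model: the $n$ vertices are fixed, edges arrive one by one (insertion-only: only insertions; insertion-deletion: insertions and deletions). Space is measured in words of $O(\log n)$ bits; $\widetilde{O}$ hides $\log^{O(1)} n$ factors; unbounded computation is allowed. *)

theory Defs
  imports Complex_Main "HOL-Library.Landau_Symbols"
begin

text \<open>The vertex set of an \<open>n\<close>-vertex graph is \<open>{..<n}\<close>; undirected edges are two-element sets.\<close>

type_synonym edge = "nat set"

definition vertex_pairs :: "nat \<Rightarrow> edge set" where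
  "vertex_pairs n = {e. e \<subseteq> {..<n} \<and> card e = 2}"

text \<open>A path is given by its list of pairwise distinct vertices; its length is its number of edges.\<close>

definition is_path :: "nat \<Rightarrow> edge set \<Rightarrow> nat list \<Rightarrow> bool" where
  "is_path n E vs \<longleftrightarrow>
     vs \<noteq> [] \<and> set vs \<subseteq> {..<n} \<and> distinct vs \<and> successively (\<lambda>u v. {u, v} \<in> E) vs"

definition path_length :: "nat list \<Rightarrow> nat" where
  "path_length vs = length vs - 1"

definition k_Path :: "nat \<Rightarrow> nat \<Rightarrow> edge set \<Rightarrow> bool" where
  "k_Path k n E \<longleftrightarrow> (\<exists>vs. is_path n E vs \<and> k \<le> path_length vs)"

datatype update = Ins edge | Del edge

fun apply_update :: "update \<Rightarrow> edge set \<Rightarrow> edge set" where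
  "apply_update (Ins e) E = insert e E"
| "apply_update (Del e) E = E - {e}"

text \<open>The input graphs are simple: only absent edges are inserted and only present edges are deleted.\<close>

fun admissible :: "nat \<Rightarrow> edge set \<Rightarrow> update list \<Rightarrow> bool" where
  "admissible n E [] \<longleftrightarrow> True"
| "admissible n E (Ins e # us) \<longleftrightarrow>
     e \<in> vertex_pairs n \<and> e \<notin> E \<and> admissible n (apply_update (Ins e) E) us"
| "admissible n E (Del e # us) \<longleftrightarrow>
     e \<in> E \<and> admissible n (apply_update (Del e) E) us"

definition insertion_deletion_streams :: "nat \<Rightarrow> update list set" where
  "insertion_deletion_streams n = {us. admissible n {} us}"

definition insertion_only_streams :: "nat \<Rightarrow> update list set" where
  "insertion_only_streams n = {us \<in> insertion_deletion_streams n. set us \<subseteq> range Ins}"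

definition final_graph :: "update list \<Rightarrow> edge set" where
  "final_graph us = fold apply_update us {}"

text \<open>
  The memory content of an algorithm is a list of machine words, each word being a natural number.
  Computation is unbounded, so the transition and output maps are arbitrary functions,
  and only the memory carried from one update to the next is charged.
\<close>

type_synonym memory = "nat list"

record streaming_algorithm =
  start :: memory
  process :: "update \<Rightarrow> memory \<Rightarrow> memory"
  answer :: "memory \<Rightarrow> bool"

definition memory_after :: "streaming_algorithm \<Rightarrow> update list \<Rightarrow> memory" where
  "memory_after A us = fold (process A) us (start A)"

definition solves_on ::
  "streaming_algorithm \<Rightarrow> update list set \<Rightarrow> (edge set \<Rightarrow> bool) \<Rightarrow> bool" where
  "solves_on A S P \<longleftrightarrow> (\<forall>us\<in>S. answer A (memory_after A us) \<longleftrightarrow> P (final_graph us))"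

text \<open>At every moment of every stream in \<open>S\<close>, at most \<open>s\<close> words of \<open>w\<close> bits each are in use.\<close>

definition space_on ::
  "streaming_algorithm \<Rightarrow> update list set \<Rightarrow> nat \<Rightarrow> real \<Rightarrow> bool" where
  "space_on A S w s \<longleftrightarrow>
     (\<forall>us\<in>S. \<forall>i\<le>length us.
        real (length (memory_after A (take i us))) \<le> s \<and>
        (\<forall>x\<in>set (memory_after A (take i us)). x < 2 ^ w))"

text \<open>Word sizes, in bits as a function of the number of vertices.\<close>

definition logarithmic_word_size :: "(nat \<Rightarrow> nat) \<Rightarrow> bool" where
  "logarithmic_word_size w \<longleftrightarrow> (\<lambda>n. real (w n)) \<in> O(\<lambda>n. log 2 (real n))"

end

theory Submission
  imports Defs
begin

text \<open>
  A graph with more than \<open>k n\<close> edges has a subgraph of minimum degree at least \<open>k\<close>, hence a path of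
  length \<open>k\<close>. So it suffices to maintain the number of edges together with a linear sketch over
  \<open>GF(2)\<close> from which an edge set of size at most \<open>s = k n\<close> can be recovered. Take a subspace \<open>W\<close>
  of the space of edge sets under symmetric difference that is maximal with the property that its
  nonempty members have more than \<open>2 s\<close> edges. Edge sets of size at most \<open>s\<close> lie in distinct cosets
  of \<open>W\<close>, and by maximality every coset has a member with at most \<open>2 s\<close> edges, which is stored.
  The sketch works for arbitrary updates and uses \<open>O(k n)\<close> words, so both claims hold with the
  same algorithm, the second without any logarithmic factor.
\<close>

subsection \<open>Long paths in dense graphs\<close>

text \<open>All neighbours of an end vertex of a longest path lie on that path, since another
  neighbour could be put in front. The degree bound thus yields \<open>k\<close> further
  vertices.\<close>

lemma path_if_min_degree:
  fixes E :: "'a set set"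
  assumes V: "finite V" "V \<noteq> {}" and E: "E \<subseteq> {e. e \<subseteq> V \<and> card e = 2}"
    and deg: "\<And>v. v \<in> V \<Longrightarrow> k \<le> card {e \<in> E. v \<in> e}"
  shows "\<exists>vs. set vs \<subseteq> V \<and> distinct vs \<and> successively (\<lambda>u v. {u, v} \<in> E) vs \<and> k < length vs"
proof -
  define P where "P vs \<longleftrightarrow> vs \<noteq> [] \<and> set vs \<subseteq> V \<and> distinct vs \<and> successively (\<lambda>u v. {u, v} \<in> E) vs"
    for vs
  obtain v0 where "v0 \<in> V" using V by blast
  then have "P [v0]" by (simp add: P_def)
  moreover have "\<forall>vs. P vs \<longrightarrow> length vs \<le> card V"
    unfolding P_def by (metis card_mono distinct_card V(1))
  ultimately obtain vs where vs: "P vs" and longest: "\<And>ws. P ws \<Longrightarrow> length ws \<le> length vs"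
    using ex_has_greatest_nat[of P "[v0]" length "Suc (card V)"] by (metis le_imp_less_Suc)
  from vs obtain x xs where x: "vs = x # xs" by (cases vs) (auto simp: P_def)
  have "{e \<in> E. x \<in> e} \<subseteq> (\<lambda>y. {x, y}) ` set xs"
  proof
    fix e assume e: "e \<in> {e \<in> E. x \<in> e}"
    then have "card e = 2" using E by blast
    then obtain a b where "e = {a, b}" "a \<noteq> b" unfolding card_2_iff by blast
    moreover have "x \<in> e" using e by simp
    ultimately obtain y where y: "e = {x, y}" "x \<noteq> y" by auto
    have "y \<in> V" using e y E by blast
    have "y \<in> set xs"
    proof (rule ccontr)
      assume "y \<notin> set xs"
      then have "P (y # vs)"
        using vs x y e \<open>y \<in> V\<close> by (auto simp: P_def insert_commute)
      then show False using longest[of "y # vs"] by simp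
    qed
    then show "e \<in> (\<lambda>y. {x, y}) ` set xs" using y by blast
  qed
  then have "card {e \<in> E. x \<in> e} \<le> card (set xs)"
    by (rule surj_card_le[rotated]) simp
  then have "k \<le> length xs"
    using deg[of x] vs x card_length[of xs] by (simp add: P_def)
  then show ?thesis using vs x unfolding P_def by fastforce
qed

text \<open>Removing a vertex of degree at most \<open>k\<close> costs at most \<open>k\<close>
  edges, so the excess over \<open>k * card V\<close> survives and induction on
  \<open>card V\<close> applies. If there is no such vertex, the minimum degree is large
  enough.\<close>

lemma path_if_many_edges:
  fixes E :: "'a set set"
  assumes "finite V" and "E \<subseteq> {e. e \<subseteq> V \<and> card e = 2}" and "k * card V < card E"
  shows "\<exists>vs. set vs \<subseteq> V \<and> distinct vs \<and> successively (\<lambda>u v. {u, v} \<in> E) vs \<and> k < length vs"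
  using assms
proof (induction "card V" arbitrary: V E)
  case 0
  then have "E = {}" by fastforce
  then show ?case using 0 by simp
next
  case (Suc m)
  \<comment> \<open>An infinite set has \<open>card\<close> 0, which the strict lower bound
    excludes.\<close>
  have finE: "finite E"
    using Suc.prems by (metis card.infinite not_less_zero)
  show ?case
  proof (cases "\<exists>v\<in>V. card {e \<in> E. v \<in> e} \<le> k")
    case True
    then obtain v where v: "v \<in> V" "card {e \<in> E. v \<in> e} \<le> k" by blast
    define E' where "E' = {e \<in> E. v \<notin> e}"
    have "E = E' \<union> {e \<in> E. v \<in> e}" "E' \<inter> {e \<in> E. v \<in> e} = {}"
      by (auto simp: E'_def)
    then have "card E = card E' + card {e \<in> E. v \<in> e}"
      using finE by (metis card_Un_disjoint finite_Un)
    moreover have m: "card (V - {v}) = m" using Suc.hyps(2) Suc.prems(1) v by simp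
    ultimately have "k * card (V - {v}) < card E'"
      using Suc.prems(3) Suc.hyps(2)[symmetric] v(2) by simp
    moreover have "E' \<subseteq> {e. e \<subseteq> V - {v} \<and> card e = 2}"
      using Suc.prems(2) by (auto simp: E'_def)
    ultimately obtain vs where "set vs \<subseteq> V - {v}" "distinct vs"
      "successively (\<lambda>u v. {u, v} \<in> E') vs" "k < length vs"
      using Suc.hyps(1)[of "V - {v}" E'] m Suc.prems(1) by auto
    moreover from this(3) have "successively (\<lambda>u v. {u, v} \<in> E) vs"
      by (rule successively_mono) (auto simp: E'_def)
    ultimately show ?thesis by blast
  next
    case False
    moreover have "V \<noteq> {}" using Suc.hyps(2) by auto
    ultimately show ?thesis
      using path_if_min_degree[of V E k] Suc.prems by fastforce
  qed
qed

lemma k_Path_if_many_edges: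
  assumes "E \<subseteq> vertex_pairs n" and "k * n < card E"
  shows "k_Path k n E"
proof -
  obtain vs where "set vs \<subseteq> {..<n}" "distinct vs"
    "successively (\<lambda>u v. {u, v} \<in> E) vs" "k < length vs"
    using path_if_many_edges[of "{..<n}" E k] assms by (auto simp: vertex_pairs_def)
  then show ?thesis
    unfolding k_Path_def is_path_def path_length_def by (intro exI[of _ vs]) auto
qed

text \<open>For \<open>n = 0\<close> there is no path, as paths are nonempty; for
  \<open>k = 0\<close> a single vertex suffices. Hence the answer ignores the edges and can be given
  without memory.\<close>

lemma k_Path_degenerate:
  assumes "k * n = 0"
  shows "k_Path k n E \<longleftrightarrow> n \<noteq> 0"
proof (cases "n = 0")
  case True
  then show ?thesis by (simp add: k_Path_def is_path_def)
next
  case False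
  then have "is_path n E [0]" "k = 0" using assms by (auto simp: is_path_def)
  then show ?thesis using False unfolding k_Path_def by blast
qed

subsection \<open>Sparse recovery by cosets\<close>

text \<open>With symmetric difference as addition these are the binary linear codes of minimum
  distance above \<open>t\<close>.\<close>

definition sparse_code :: "'a set \<Rightarrow> nat \<Rightarrow> 'a set set \<Rightarrow> bool" where
  "sparse_code V t W \<longleftrightarrow> W \<subseteq> Pow V \<and> {} \<in> W \<and> (\<forall>A\<in>W. \<forall>B\<in>W. sym_diff A B \<in> W) \<and>
     (\<forall>A\<in>W. A \<noteq> {} \<longrightarrow> t < card A)"

text \<open>In coding terms, the covering radius is at most \<open>t\<close>.\<close>

definition covering_code :: "'a set \<Rightarrow> nat \<Rightarrow> 'a set set \<Rightarrow> bool" where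
  "covering_code V t W \<longleftrightarrow> (\<forall>A\<subseteq>V. \<exists>B\<subseteq>V. card B \<le> t \<and> sym_diff A B \<in> W)"

text \<open>The Gilbert-Varshamov argument: if a coset of a maximal sparse code had only members
  larger than \<open>t\<close>, adjoining this coset would give a larger sparse code.\<close>

lemma ex_sparse_covering_code:
  assumes "finite V"
  shows "\<exists>W. sparse_code V t W \<and> covering_code V t W"
proof -
  have "finite (Collect (sparse_code V t))"
  proof (rule finite_subset)
    show "Collect (sparse_code V t) \<subseteq> Pow (Pow V)" by (simp add: sparse_code_def subset_iff)
  qed (simp add: assms)
  moreover have "{{}} \<in> Collect (sparse_code V t)" by (simp add: sparse_code_def)
  ultimately obtain W where W: "sparse_code V t W"
    and max: "\<And>W'. sparse_code V t W' \<Longrightarrow> W \<subseteq> W' \<Longrightarrow> W = W'"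
    using finite_has_maximal[of "Collect (sparse_code V t)"] by auto
  have closed: "sym_diff A B \<in> W" if "A \<in> W" "B \<in> W" for A B
    using W that by (simp add: sparse_code_def)
  have "\<exists>B\<subseteq>V. card B \<le> t \<and> sym_diff A B \<in> W" if "A \<subseteq> V" for A
  proof (cases "A \<in> W")
    case True
    then show ?thesis by (intro exI[of _ "{}"]) auto
  next
    case False
    \<comment> \<open>Over GF(2) this is the span of \<open>W\<close> and \<open>A\<close>.\<close>
    define W' where "W' = W \<union> sym_diff A ` W"
    have "{} \<in> W" using W by (simp add: sparse_code_def)
    then have "sym_diff A {} \<in> W'" unfolding W'_def by blast
    then have "A \<in> W'" by simp
    then have "\<not> sparse_code V t W'"
      using max[of W'] False by (auto simp: W'_def)
    moreover have "W' \<subseteq> Pow V" "{} \<in> W'"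
      using W \<open>A \<subseteq> V\<close> by (auto simp: W'_def sparse_code_def)
    moreover have "\<forall>X\<in>W'. \<forall>Y\<in>W'. sym_diff X Y \<in> W'"
    proof (intro ballI)
      have eqs: "sym_diff (sym_diff A C) D = sym_diff A (sym_diff C D)"
        "sym_diff C (sym_diff A D) = sym_diff A (sym_diff C D)"
        "sym_diff (sym_diff A C) (sym_diff A D) = sym_diff C D" for C D
        by blast+
      fix X Y assume "X \<in> W'" "Y \<in> W'"
      then consider "X \<in> W" "Y \<in> W" | C where "C \<in> W" "X = sym_diff A C" "Y \<in> W"
        | D where "D \<in> W" "X \<in> W" "Y = sym_diff A D"
        | C D where "C \<in> W" "D \<in> W" "X = sym_diff A C" "Y = sym_diff A D"
        unfolding W'_def by (elim UnE imageE)
      then show "sym_diff X Y \<in> W'"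
      proof cases
        case 1
        then show ?thesis using closed by (simp add: W'_def)
      next
        case (2 C)
        then show ?thesis using closed[of C Y] eqs(1)[of C Y] by (simp only: W'_def UnI2 image_eqI)
      next
        case (3 D)
        then show ?thesis using closed[of X D] eqs(2)[of X D] by (simp only: W'_def UnI2 image_eqI)
      next
        case (4 C D)
        then show ?thesis using closed[of C D] eqs(3)[of C D] by (simp only: W'_def UnI1)
      qed
    qed
    \<comment> \<open>\<open>W'\<close> is a subspace, so only the size condition of
      \<open>sparse_code\<close> can fail.\<close>
    ultimately obtain B where B: "B \<in> W'" "B \<noteq> {}" "card B \<le> t"
      unfolding sparse_code_def by (meson not_less)
    then have "B \<notin> W" using W by (auto simp: sparse_code_def)
    then obtain C where "C \<in> W" "B = sym_diff A C" using B by (auto simp: W'_def)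
    then have "sym_diff A B = C" by blast
    then show ?thesis
      using \<open>C \<in> W\<close> B \<open>W' \<subseteq> Pow V\<close> by blast
  qed
  then show ?thesis using W unfolding covering_code_def by blast
qed

text \<open>The two congruences add up to a code member \<open>sym_diff A B\<close>, in which
  \<open>R\<close> cancels. It has at most \<open>2 * s\<close> elements, so it is empty.\<close>

lemma sparse_code_unique:
  assumes W: "sparse_code V (2 * s) W"
    and fin: "finite A" "finite B" and card: "card A \<le> s" "card B \<le> s"
    and cong: "sym_diff A R \<in> W" "sym_diff B R \<in> W"
  shows "A = B"
proof -
  have "sym_diff (sym_diff A R) (sym_diff B R) = sym_diff A B" by blast
  then have "sym_diff A B \<in> W"
    using W cong unfolding sparse_code_def by metis
  moreover have "card (sym_diff A B) \<le> card (A \<union> B)"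
    using fin by (intro card_mono) auto
  then have "card (sym_diff A B) \<le> 2 * s"
    using card_Un_le[of A B] card by linarith
  ultimately have "sym_diff A B = {}"
    using W unfolding sparse_code_def by (meson not_less)
  then show ?thesis by blast
qed

subsection \<open>The streaming algorithm\<close>

lemma finite_vertex_pairs: "finite (vertex_pairs n)"
  by (rule finite_subset[of _ "Pow {..<n}"]) (auto simp: vertex_pairs_def)

lemma card_vertex_pairs_le: "card (vertex_pairs n) \<le> n ^ 2"
proof -
  have "vertex_pairs n \<subseteq> (\<lambda>(u, v). {u, v}) ` ({..<n} \<times> {..<n})"
    by (auto simp: vertex_pairs_def card_2_iff)
  then have "card (vertex_pairs n) \<le> card ({..<n} \<times> {..<n})"
    by (rule surj_card_le[rotated]) simp
  then show ?thesis by (simp add: power2_eq_square)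
qed

definition graph_code :: "nat \<Rightarrow> nat \<Rightarrow> edge set set" where
  "graph_code n k = (SOME W. sparse_code (vertex_pairs n) (2 * (k * n)) W \<and>
     covering_code (vertex_pairs n) (2 * (k * n)) W)"

definition coset_rep :: "nat \<Rightarrow> nat \<Rightarrow> edge set \<Rightarrow> edge set" where
  "coset_rep n k A = (SOME B. B \<subseteq> vertex_pairs n \<and> card B \<le> 2 * (k * n) \<and>
     sym_diff A B \<in> graph_code n k)"

text \<open>Numbering the vertex pairs lets one word hold a whole edge.\<close>

definition edge_word :: "nat \<Rightarrow> edge \<Rightarrow> nat" where
  "edge_word n = (SOME f. bij_betw f (vertex_pairs n) {0..<card (vertex_pairs n)})"

definition store :: "nat \<Rightarrow> edge set \<Rightarrow> nat list" where
  "store n R = sorted_list_of_set (edge_word n ` R)"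

definition load :: "nat \<Rightarrow> nat list \<Rightarrow> edge set" where
  "load n xs = {e \<in> vertex_pairs n. edge_word n e \<in> set xs}"

fun updated_edge :: "update \<Rightarrow> edge" where
  "updated_edge (Ins e) = e"
| "updated_edge (Del e) = e"

fun updated_count :: "update \<Rightarrow> nat \<Rightarrow> nat" where
  "updated_count (Ins e) c = c + 1"
| "updated_count (Del e) c = c - 1"

text \<open>The head of the memory counts edges, the tail encodes a small representative of the
  coset of the current graph. Insertion and deletion both toggle an edge, so one rule serves both.
  The answer searches all sparse graphs in the coset, which unbounded computation permits.\<close>

definition sketch_algorithm :: "nat \<Rightarrow> nat \<Rightarrow> streaming_algorithm" where
  "sketch_algorithm n k =
     \<lparr>start = [0],
      process = (\<lambda>u M. updated_count u (hd M) #
        store n (coset_rep n k (sym_diff (load n (tl M)) {updated_edge u}))),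
      answer = (\<lambda>M. k * n < hd M \<or>
        (\<exists>E\<subseteq>vertex_pairs n. card E \<le> k * n \<and> sym_diff E (load n (tl M)) \<in> graph_code n k \<and>
          k_Path k n E))\<rparr>"

text \<open>If \<open>k n = 0\<close>, not even a single word may be used.\<close>

definition path_algorithm :: "nat \<Rightarrow> nat \<Rightarrow> streaming_algorithm" where
  "path_algorithm n k =
     (if k * n = 0 then \<lparr>start = [], process = (\<lambda>_ _. []), answer = (\<lambda>_. n \<noteq> 0)\<rparr>
      else sketch_algorithm n k)"

text \<open>Counts and edge numbers are bounded by \<open>n ^ 2\<close>, hence the factor 2; the
  extra bit makes the bound strict.\<close>

definition word_size :: "nat \<Rightarrow> nat" where
  "word_size n = 2 * nat \<lceil>log 2 (real n)\<rceil> + 1"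

section \<open>Correctness of the sketch\<close>

lemma graph_code:
  "sparse_code (vertex_pairs n) (2 * (k * n)) (graph_code n k)"
  "covering_code (vertex_pairs n) (2 * (k * n)) (graph_code n k)"
  using someI_ex[OF ex_sparse_covering_code[OF finite_vertex_pairs[of n], of "2 * (k * n)"]]
  unfolding graph_code_def by blast+

lemma coset_rep:
  assumes "A \<subseteq> vertex_pairs n"
  shows "coset_rep n k A \<subseteq> vertex_pairs n" "card (coset_rep n k A) \<le> 2 * (k * n)"
    "sym_diff A (coset_rep n k A) \<in> graph_code n k"
proof -
  have "\<exists>B. B \<subseteq> vertex_pairs n \<and> card B \<le> 2 * (k * n) \<and> sym_diff A B \<in> graph_code n k"
    using graph_code(2)[of n k] assms unfolding covering_code_def by blast
  from someI_ex[OF this]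
  show "coset_rep n k A \<subseteq> vertex_pairs n" "card (coset_rep n k A) \<le> 2 * (k * n)"
    "sym_diff A (coset_rep n k A) \<in> graph_code n k"
    unfolding coset_rep_def by blast+
qed

lemma bij_betw_edge_word: "bij_betw (edge_word n) (vertex_pairs n) {0..<card (vertex_pairs n)}"
  unfolding edge_word_def by (rule someI_ex[OF ex_bij_betw_finite_nat[OF finite_vertex_pairs]])

lemma store:
  assumes "R \<subseteq> vertex_pairs n"
  shows "load n (store n R) = R" "length (store n R) \<le> card R"
    "\<forall>x\<in>set (store n R). x < card (vertex_pairs n)"
proof -
  have fin: "finite R" using assms finite_vertex_pairs finite_subset by blast
  have "inj_on (edge_word n) (vertex_pairs n)"
    using bij_betw_edge_word by (rule bij_betw_imp_inj_on)
  then show "load n (store n R) = R"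
    using assms fin by (auto simp: load_def store_def dest: inj_onD)
  show "length (store n R) \<le> card R"
    using fin by (simp add: store_def card_image_le)
  show "\<forall>x\<in>set (store n R). x < card (vertex_pairs n)"
    using fin assms bij_betwE[OF bij_betw_edge_word[of n]] by (auto simp: store_def)
qed

text \<open>The streaming invariant. \<open>E\<close> itself may be dense; \<open>R\<close> is only
  congruent to it modulo the code, while the count is exact.\<close>

definition represents :: "nat \<Rightarrow> nat \<Rightarrow> memory \<Rightarrow> edge set \<Rightarrow> bool" where
  "represents n k M E \<longleftrightarrow> (\<exists>R\<subseteq>vertex_pairs n. card R \<le> 2 * (k * n) \<and>
     sym_diff E R \<in> graph_code n k \<and> M = card E # store n R)"

lemma represents_start: "represents n k [0] {}"
  using graph_code(1)[of n k] unfolding represents_def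
  by (intro exI[of _ "{}"]) (auto simp: store_def sparse_code_def)

lemma represents_step:
  assumes rep: "represents n k M E" and E: "E \<subseteq> vertex_pairs n" and adm: "admissible n E [u]"
  shows "represents n k (process (sketch_algorithm n k) u M) (apply_update u E)"
proof -
  define e where "e = updated_edge u"
  obtain R where R: "R \<subseteq> vertex_pairs n" "sym_diff E R \<in> graph_code n k" "M = card E # store n R"
    using rep unfolding represents_def by blast
  define R' where "R' = coset_rep n k (sym_diff R {e})"
  have fin: "finite E" using E finite_vertex_pairs finite_subset by blast
  have e: "e \<in> vertex_pairs n" using adm E by (cases u) (auto simp: e_def)
  \<comment> \<open>Admissibility enters here: inserted edges are absent and deleted ones present,
    so each update is a toggle and changes the count by exactly one.\<close>
  have upd: "apply_update u E = sym_diff E {e}" and cnt: "updated_count u (card E) = card (apply_update u E)"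
    using adm fin by (cases u; auto simp: e_def)+
  have R': "R' \<subseteq> vertex_pairs n" "card R' \<le> 2 * (k * n)" "sym_diff (sym_diff R {e}) R' \<in> graph_code n k"
    using coset_rep[of "sym_diff R {e}" n k] R(1) e unfolding R'_def by auto
  \<comment> \<open>\<open>R\<close> cancels, which writes the new difference as a sum of two code
    members.\<close>
  have "sym_diff (sym_diff E {e}) R' = sym_diff (sym_diff E R) (sym_diff (sym_diff R {e}) R')"
    by blast
  then have "sym_diff (apply_update u E) R' \<in> graph_code n k"
    using R(2) R'(3) graph_code(1)[of n k] unfolding upd sparse_code_def by metis
  moreover have "process (sketch_algorithm n k) u M = card (apply_update u E) # store n R'"
    using R(3) store(1)[OF R(1)] cnt by (simp add: sketch_algorithm_def R'_def e_def)
  ultimately show ?thesis using R' unfolding represents_def by blast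
qed

lemma represents_fold:
  assumes "represents n k M E" "E \<subseteq> vertex_pairs n" "admissible n E us"
  shows "represents n k (fold (process (sketch_algorithm n k)) us M) (fold apply_update us E) \<and>
    fold apply_update us E \<subseteq> vertex_pairs n"
  using assms
proof (induction us arbitrary: M E)
  case (Cons u us)
  have adm: "admissible n E [u]" "admissible n (apply_update u E) us"
    using Cons.prems(3) by (cases u; simp)+
  moreover have "apply_update u E \<subseteq> vertex_pairs n"
    using Cons.prems adm by (cases u) auto
  ultimately show ?case
    using Cons.IH[OF represents_step[OF Cons.prems(1,2) adm(1)]] by simp
qed simp

lemma represents_memory_after:
  assumes "us \<in> insertion_deletion_streams n"
  shows "represents n k (memory_after (sketch_algorithm n k) us) (final_graph us)"
    "final_graph us \<subseteq> vertex_pairs n"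
  using represents_fold[OF represents_start, of n us k] assms
  by (auto simp: insertion_deletion_streams_def memory_after_def final_graph_def sketch_algorithm_def)

text \<open>A count above \<open>k * n\<close> forces a path. Otherwise \<open>E\<close> is the only
  sparse graph congruent to \<open>R\<close>, so the search tests \<open>E\<close> itself.\<close>

lemma answer_represents:
  assumes rep: "represents n k M E" and E: "E \<subseteq> vertex_pairs n"
  shows "answer (sketch_algorithm n k) M \<longleftrightarrow> k_Path k n E"
proof -
  obtain R where R: "R \<subseteq> vertex_pairs n" "sym_diff E R \<in> graph_code n k" "M = card E # store n R"
    using rep unfolding represents_def by blast
  have ans: "answer (sketch_algorithm n k) M \<longleftrightarrow> k * n < card E \<or>
    (\<exists>F\<subseteq>vertex_pairs n. card F \<le> k * n \<and> sym_diff F R \<in> graph_code n k \<and> k_Path k n F)"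
    using R(3) store(1)[OF R(1)] by (simp add: sketch_algorithm_def)
  show ?thesis
  proof (cases "k * n < card E")
    case True
    then show ?thesis using ans k_Path_if_many_edges[OF E] by blast
  next
    case False
    then have "F = E" if "F \<subseteq> vertex_pairs n" "card F \<le> k * n" "sym_diff F R \<in> graph_code n k" for F
      using that sparse_code_unique[OF graph_code(1)] R(2) E finite_subset[OF _ finite_vertex_pairs]
      by (metis not_less)
    then show ?thesis using ans False R(2) E by (metis not_less)
  qed
qed

section \<open>Space bound and conclusion\<close>

lemma admissible_take: "admissible n E us \<Longrightarrow> admissible n E (take i us)"
proof (induction us arbitrary: E i)
  case (Cons u us)
  then show ?case by (cases u; cases i) auto
qed simp

lemma square_less_word_size:
  assumes "0 < n"
  shows "n ^ 2 < 2 ^ word_size n"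
proof -
  define l where "l = nat \<lceil>log 2 (real n)\<rceil>"
  have "log 2 (real n) \<le> real l" unfolding l_def by linarith
  then have "real n \<le> 2 powr real l" using assms by (simp add: log_le_iff)
  then have "real n \<le> real (2 ^ l)" by (simp add: powr_realpow)
  then have "n \<le> 2 ^ l" by (simp only: of_nat_le_iff)
  then have "n ^ 2 \<le> (2 ^ l) ^ 2" by (rule power_mono) simp
  also have "\<dots> < 2 ^ (2 * l + 1)" by (simp add: power_mult[symmetric] mult.commute)
  finally show ?thesis by (simp add: word_size_def l_def)
qed

lemma logarithmic_word_size: "logarithmic_word_size word_size"
  unfolding logarithmic_word_size_def
\<comment> \<open>Rounding up gives at most \<open>2 * (log 2 n + 1) + 1\<close>, and
  \<open>1 \<le> log 2 n\<close> from \<open>n = 2\<close> on absorbs the constant 3.\<close>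
proof (rule bigoI[where c = 5], rule eventually_mono[OF eventually_ge_at_top[of 2]])
  fix n :: nat assume "2 \<le> n"
  then have "1 \<le> log 2 (real n)" by (simp add: le_log_iff)
  moreover have "real_of_int \<lceil>log 2 (real n)\<rceil> \<le> log 2 (real n) + 1" by linarith
  ultimately have "1 + 2 * real_of_int \<lceil>log 2 (real n)\<rceil> \<le> 5 * log 2 (real n)" by linarith
  then show "norm (real (word_size n)) \<le> 5 * norm (log 2 (real n))"
    using \<open>1 \<le> log 2 (real n)\<close> by (simp add: word_size_def)
qed

lemma path_algorithm_solves:
  "solves_on (path_algorithm n k) (insertion_deletion_streams n) (k_Path k n)"
proof (cases "k * n = 0")
  case True
  then show ?thesis by (simp add: solves_on_def path_algorithm_def k_Path_degenerate del: mult_eq_0_iff)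
next
  case False
  then show ?thesis
    using answer_represents[OF represents_memory_after]
    by (simp add: solves_on_def path_algorithm_def del: mult_eq_0_iff)
qed

lemma path_algorithm_space:
  "space_on (path_algorithm n k) (insertion_deletion_streams n) (word_size n) (3 * (real k * real n))"
proof (cases "k * n = 0")
  case True
  have "fold (\<lambda>_ _. []) us [] = ([] :: memory)" for us :: "update list" by (induction us) auto
  then show ?thesis using True
    by (simp add: space_on_def path_algorithm_def memory_after_def del: mult_eq_0_iff)
next
  case False
  then have n: "0 < n" by simp
  show ?thesis
    unfolding space_on_def
  proof (intro ballI allI impI)
    fix us i assume us: "us \<in> insertion_deletion_streams n"
    define M where "M = memory_after (path_algorithm n k) (take i us)"
    define E where "E = final_graph (take i us)"
    have "take i us \<in> insertion_deletion_streams n"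
      using us by (simp add: insertion_deletion_streams_def admissible_take)
    from represents_memory_after(1)[OF this, of k] represents_memory_after(2)[OF this]
    have "represents n k M E" and E: "E \<subseteq> vertex_pairs n"
      using False by (simp_all add: M_def E_def path_algorithm_def del: mult_eq_0_iff)
    then obtain R where R: "R \<subseteq> vertex_pairs n" "card R \<le> 2 * (k * n)" "M = card E # store n R"
      unfolding represents_def by blast
    have "length M = Suc (length (store n R))" using R(3) by simp
    \<comment> \<open>The representative takes at most \<open>2 * (k * n)\<close> words; the single
      word for the count is at most \<open>k * n\<close>, which is positive here.\<close>
    then have "length M \<le> 3 * (k * n)" using R(2) store(2)[OF R(1)] False by linarith
    then have "real (length M) \<le> real (3 * (k * n))" by (simp only: of_nat_le_iff)
    moreover have "card E \<le> card (vertex_pairs n)"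
      using E finite_vertex_pairs by (rule card_mono[rotated])
    then have "x \<le> card (vertex_pairs n)" if "x \<in> set M" for x
      using that R(3) store(3)[OF R(1)] by fastforce
    then have "\<forall>x\<in>set M. x < 2 ^ word_size n"
      using card_vertex_pairs_le[of n] square_less_word_size[OF n] by (meson le_less_trans)
    ultimately show "real (length (memory_after (path_algorithm n k) (take i us))) \<le> 3 * (real k * real n) \<and>
        (\<forall>x\<in>set (memory_after (path_algorithm n k) (take i us)). x < 2 ^ word_size n)"
      unfolding M_def by simp
  qed
qed

theorem theorem22:
  shows
    "(\<exists>(A :: nat \<Rightarrow> nat \<Rightarrow> streaming_algorithm) (w :: nat \<Rightarrow> nat) (C :: real).
        logarithmic_word_size w \<and>
        (\<forall>n k. solves_on (A n k) (insertion_only_streams n) (k_Path k n) \<and>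
               space_on (A n k) (insertion_only_streams n) (w n) (C * (real k * real n)))) \<and>
     (\<exists>(A :: nat \<Rightarrow> nat \<Rightarrow> streaming_algorithm) (w :: nat \<Rightarrow> nat) (C :: real) (d :: nat).
        logarithmic_word_size w \<and>
        (\<forall>n k. solves_on (A n k) (insertion_deletion_streams n) (k_Path k n) \<and>
               space_on (A n k) (insertion_deletion_streams n) (w n)
                 (C * (real k * real n) * log 2 (real n) ^ d)))"
proof -
  have "insertion_only_streams n \<subseteq> insertion_deletion_streams n" for n
    by (auto simp: insertion_only_streams_def)
  then have "solves_on (path_algorithm n k) (insertion_only_streams n) (k_Path k n) \<and>
    space_on (path_algorithm n k) (insertion_only_streams n) (word_size n) (3 * (real k * real n))" for n k
    using path_algorithm_solves[of n k] path_algorithm_space[of n k]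
    unfolding solves_on_def space_on_def by blast
  \<comment> \<open>The exponent \<open>d = 0\<close> suffices, since the bound has no logarithmic
    factor.\<close>
  moreover have "solves_on (path_algorithm n k) (insertion_deletion_streams n) (k_Path k n) \<and>
    space_on (path_algorithm n k) (insertion_deletion_streams n) (word_size n)
      (3 * (real k * real n) * log 2 (real n) ^ 0)" for n k
    using path_algorithm_solves path_algorithm_space by simp
  ultimately show ?thesis using logarithmic_word_size by blast
qed

end
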